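(* Let $t_0\in\mathbb{R}$ be a local maximum or a local minimum of the real-valued function $t\mapsto \xi(1/2+it)$ on $\mathbb{R}$. Then the real level curve of $\xi$ meets the critical line at $1/2+it_0$; that is, $1/2+it_0$ belongs to the closure of the set $$\{z\in\mathbb{C}\setminus\{0,1\}:\ \operatorname{Im}\,\xi(z)=0,\ \operatorname{Re} z\ne 1/2\}.$$
   Context: For $z\in\mathbb{C}\setminus\{0,1\}$, the Xi function is $$\xi(z)=-\frac1z+\frac1{z-1}+\int_1^\infty\left(x^{z/2-1}+x^{-(z+1)/2}\right)\omega(x)\,dx,\qquad \omega(x)=\sum_{n=1}^\infty e^{-\pi n^2x}.$$ It is holomorphic on $\mathbb{C}\setminus\{0,1\}$, and satisfies $\xi(z)=\xi(1-z)$ and $\xi(\overline z)=\overline{\xi(z)}$, so $\xi$ is real on the critical line $\operatorname{Re} z=1/2$. The "real level curve" is the locus $\operatorname{Im}\,\xi(z)=0$. Since the critical line itself lies in this locus, an intersection of the real level curve with the critical line means a point where a part of the locus off the critical line reaches the critical line. *)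

theory Defs
  imports "HOL-Analysis.Analysis"
begin

definition omega :: "real \<Rightarrow> real" where
  "omega x = (\<Sum>n. exp (- pi * (real (Suc n))\<^sup>2 * x))"

text \<open>
  The definition is meaningful for arguments other than 0 and 1 only; there, the values are
  artefacts of division by zero.
\<close>

definition xi :: "complex \<Rightarrow> complex" where
  "xi z = - (1 / z) + 1 / (z - 1) +
     (LBINT x:{1..}. (complex_of_real x powr (z / 2 - 1) + complex_of_real x powr (- (z + 1) / 2)) *
        complex_of_real (omega x))"

definition local_max_at :: "(real \<Rightarrow> real) \<Rightarrow> real \<Rightarrow> bool" where
  "local_max_at f t\<^sub>0 \<longleftrightarrow> (\<forall>\<^sub>F t in nhds t\<^sub>0. f t \<le> f t\<^sub>0)"

definition local_min_at :: "(real \<Rightarrow> real) \<Rightarrow> real \<Rightarrow> bool" where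
  "local_min_at f t\<^sub>0 \<longleftrightarrow> (\<forall>\<^sub>F t in nhds t\<^sub>0. f t\<^sub>0 \<le> f t)"

lemma xi_reflect: "xi (1 - z) = xi z"
proof -
  have e: "(1 - z) / 2 - 1 = - (z + 1) / 2" "- (1 - z + 1) / 2 = z / 2 - 1"
    by (simp_all add: field_simps)
  have f: "- (1 / (1 - z)) + 1 / (1 - z - 1) = - (1 / z) + 1 / (z - 1)"
    by (simp add: divide_minus_right [symmetric] del: divide_minus_right)
  show ?thesis
    unfolding xi_def e f by (simp only: add.commute)
qed

lemma xi_cnj: "xi (cnj z) = cnj (xi z)"
proof -
  have "(LBINT x:{1..}. (complex_of_real x powr (cnj z / 2 - 1)
            + complex_of_real x powr (- (cnj z + 1) / 2)) * complex_of_real (omega x))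
      = (LBINT x:{1..}. cnj ((complex_of_real x powr (z / 2 - 1)
            + complex_of_real x powr (- (z + 1) / 2)) * complex_of_real (omega x)))"
    by (rule set_lebesgue_integral_cong) (auto simp: cnj_powr)
  also have "\<dots> = cnj (LBINT x:{1..}. (complex_of_real x powr (z / 2 - 1)
            + complex_of_real x powr (- (z + 1) / 2)) * complex_of_real (omega x))"
    unfolding set_lebesgue_integral_def
    unfolding complex_cnj_scaleR [symmetric]
    by (rule integral_bounded_linear' [OF bounded_linear_cnj bounded_linear_cnj]) simp
  finally show ?thesis
    by (simp add: xi_def)
qed

text \<open>
  Hence taking the real part of \<^term>\<open>xi\<close> on the critical line loses no information.
\<close>

lemma xi_critical_line_real: "complex_of_real (Re (xi (Complex (1 / 2) t))) = xi (Complex (1 / 2) t)"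
proof -
  have "cnj (Complex (1 / 2) t) = 1 - Complex (1 / 2) t"
    by (simp add: complex_eq_iff)
  then have "cnj (xi (Complex (1 / 2) t)) = xi (Complex (1 / 2) t)"
    by (metis xi_cnj xi_reflect)
  then show ?thesis
    by (simp add: complex_eq_iff)
qed

end

theory Submission
  imports Defs "HOL-Complex_Analysis.Complex_Analysis"
begin

text \<open>
  The theorem is a consequence of the open mapping theorem. Suppose that \<open>\<xi>\<close> restricted to the
  critical line has a local maximum at \<open>z\<^sub>0 = 1/2 + i t\<^sub>0\<close>. If \<open>\<xi>\<close> is not constant near \<open>z\<^sub>0\<close>, the
  image of an arbitrarily small disc about \<open>z\<^sub>0\<close> is open and therefore contains a real number
  larger than \<open>\<xi>(z\<^sub>0)\<close>. By maximality this value is not taken on the part of the critical line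
  in the disc, so it is taken at a point off the line, which lies on the real level curve. If \<open>\<xi>\<close>
  is constant near \<open>z\<^sub>0\<close>, the constant is real and every nearby point lies on that curve. A minimum
  of \<open>\<xi>\<close> is a maximum of \<open>-\<xi>\<close>. This is lemma \<open>local_max_imp_closure_real_level\<close>.

  What remains is that \<open>\<xi>\<close> is holomorphic (lemma \<open>xi_holomorphic\<close>). The integrals over \<open>[1,n]\<close>
  are holomorphic by differentiation under the integral sign, and they converge locally uniformly,
  since \<open>\<omega>(x) = O(e\<^bsup>-2x\<^esup>)\<close> dominates every power of \<open>x\<close>.
\<close>

section \<open>Local maxima along a set and the open mapping theorem\<close>

text \<open>
  When \<open>f\<close> is not constant near \<open>z\<^sub>0\<close>, openness of the image of a disc provides a real value above
  \<open>f z\<^sub>0\<close>, which maximality pushes off \<open>L\<close>. The assumption that \<open>L\<close> contains no disc about \<open>z\<^sub>0\<close>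
  provides the points off \<open>L\<close> when \<open>f\<close> is locally constant.
\<close>

lemma local_max_imp_closure_real_level:
  fixes f :: "complex \<Rightarrow> complex"
  assumes hol: "f holomorphic_on S" and S: "open S" "z\<^sub>0 \<in> S"
    and real: "Im (f z\<^sub>0) = 0"
    and max: "\<forall>\<^sub>F z in nhds z\<^sub>0. z \<in> L \<longrightarrow> Re (f z) \<le> Re (f z\<^sub>0)"
    and thin: "z\<^sub>0 \<notin> interior L"
  shows "z\<^sub>0 \<in> closure {z \<in> S - L. Im (f z) = 0}"
  unfolding closure_approachable
proof (intro allI impI)
  fix e :: real assume "e > 0"
  obtain d1 where d1: "d1 > 0" "\<And>z. dist z z\<^sub>0 < d1 \<Longrightarrow> z \<in> L \<Longrightarrow> Re (f z) \<le> Re (f z\<^sub>0)"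
    using max unfolding eventually_nhds_metric by blast
  obtain d2 where d2: "d2 > 0" "ball z\<^sub>0 d2 \<subseteq> S"
    using S openE by blast
  define B where "B = ball z\<^sub>0 (min e (min d1 d2))"
  have B: "open B" "connected B" "z\<^sub>0 \<in> B" "B \<subseteq> S"
    using \<open>e > 0\<close> d1(1) d2 by (auto simp: B_def)
  have "\<exists>z\<in>B. z \<notin> L \<and> Im (f z) = 0"
  proof (cases "f constant_on B")
    case True
    obtain z where "z \<in> B" "z \<notin> L"
      using thin B interiorI by blast
    moreover have "f z = f z\<^sub>0"
      using True \<open>z \<in> B\<close> B(3) by (auto simp: constant_on_def)
    ultimately show ?thesis
      using real by auto
  next
    case False
    have "open (f ` B)"
      using open_mapping_thm[OF _ B(1,2,1) order_refl False] hol B(4) holomorphic_on_subset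
      by blast
    then obtain r where r: "r > 0" "ball (f z\<^sub>0) r \<subseteq> f ` B"
      using B(3) openE by blast
    have "f z\<^sub>0 + of_real (r / 2) \<in> ball (f z\<^sub>0) r"
      using r(1) by (simp add: dist_norm)
    then obtain z where z: "z \<in> B" "f z = f z\<^sub>0 + of_real (r / 2)"
      using r(2) by (metis imageE subsetD)
    have "Re (f z) > Re (f z\<^sub>0)" "Im (f z) = 0"
      using z(2) r(1) real by auto
    moreover have "z \<in> L \<Longrightarrow> Re (f z) \<le> Re (f z\<^sub>0)"
      using z(1) d1(2) by (simp add: B_def dist_commute)
    ultimately show ?thesis
      using z(1) by force
  qed
  then show "\<exists>z\<in>{z \<in> S - L. Im (f z) = 0}. dist z z\<^sub>0 < e"
    using B(4) by (auto simp: B_def dist_commute)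
qed

section \<open>Holomorphy of integrals over a half-line\<close>

text \<open>
  The integrals over \<open>[a, a + n]\<close> are holomorphic by the Leibniz rule. Near a given point, their
  distance to the integral over the half-line is at most the tail of the integral of the dominating
  function, so the convergence is locally uniform and the limit is holomorphic.
\<close>

lemma holomorphic_on_integral_half_line:
  fixes f fx :: "complex \<Rightarrow> real \<Rightarrow> complex"
  assumes U: "open U" "convex U"
    and deriv: "\<And>z x. z \<in> U \<Longrightarrow> x \<ge> a \<Longrightarrow> ((\<lambda>z. f z x) has_field_derivative fx z x) (at z)"
    and contx: "continuous_on (U \<times> {a..}) (\<lambda>(z, x). fx z x)"
    and cont: "\<And>z. z \<in> U \<Longrightarrow> continuous_on {a..} (f z)"
    and dom: "\<And>z. z \<in> U \<Longrightarrow> \<exists>r>0. \<exists>g::real \<Rightarrow> real. cball z r \<subseteq> U \<and> set_integrable lborel {a..} g \<and>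
                (\<forall>w\<in>cball z r. \<forall>x\<ge>a. norm (f w x) \<le> g x)"
  shows "(\<lambda>z. LBINT x:{a..}. f z x) holomorphic_on U"
proof (rule holomorphic_uniform_sequence[OF U(1)])
  fix n :: nat
  have int: "set_integrable lborel {a..a + real n} (f z)" if "z \<in> U" for z
    using cont[OF that] by (intro borel_integrable_atLeastAtMost') (auto elim: continuous_on_subset)
  have "(\<lambda>z. integral (cbox a (a + real n)) (f z)) holomorphic_on U"
  proof (rule leibniz_rule_holomorphic)
    show "f z integrable_on cbox a (a + real n)" if "z \<in> U" for z
      using set_borel_integral_eq_integral(1)[OF int[OF that]] by simp
    show "continuous_on (U \<times> cbox a (a + real n)) (\<lambda>(z, x). fx z x)"
      by (rule continuous_on_subset[OF contx]) auto
  qed (use deriv U in \<open>auto intro: has_field_derivative_at_within\<close>)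
  then show "(\<lambda>z. LBINT x:{a..a + real n}. f z x) holomorphic_on U"
    by (rule holomorphic_transform) (simp add: set_borel_integral_eq_integral(2) int)
next
  fix z assume "z \<in> U"
  then obtain r g where r: "r > 0" "cball z r \<subseteq> U" and g: "set_integrable lborel {a..} g"
    and le: "\<And>w x. w \<in> cball z r \<Longrightarrow> x \<ge> a \<Longrightarrow> norm (f w x) \<le> (g x :: real)"
    using dom by metis
  have int: "set_integrable lborel {a..} (f w)" if "w \<in> cball z r" for w
  proof (rule set_integrable_bound[OF g])
    show "set_borel_measurable lborel {a..} (f w)"
      using set_measurable_continuous_on[OF _ cont[of w]] r(2) that
      by (auto simp: set_borel_measurable_def)
    show "AE x in lborel. x \<in> {a..} \<longrightarrow> norm (f w x) \<le> norm (g x)"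
      using le[OF that] by (auto intro!: AE_I2 order_trans[OF le[OF that]])
  qed
  have tail: "(LBINT x:{a..}. h x) - (LBINT x:{a..a + real n}. h x) = (LBINT x:{a + real n<..}. h x)"
    if h: "set_integrable lborel {a..} h"
    for n and h :: "real \<Rightarrow> 'b :: {banach, second_countable_topology}"
  proof -
    have eq: "{a..} = {a..a + real n} \<union> {a + real n<..}"
      by auto
    have "(LBINT x:{a..}. h x) = (LBINT x:{a..a + real n}. h x) + (LBINT x:{a + real n<..}. h x)"
      unfolding eq using h by (intro set_integral_Un) (auto intro: set_integrable_subset)
    then show ?thesis
      by simp
  qed
  have bound: "norm ((LBINT x:{a..}. f w x) - (LBINT x:{a..a + real n}. f w x))
        \<le> (LBINT x:{a..}. g x) - (LBINT x:{a..a + real n}. g x)" if w: "w \<in> cball z r" for w n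
  proof -
    have sub: "set_integrable lborel {a + real n<..} (f w)" "set_integrable lborel {a + real n<..} g"
      using int[OF w] g by (auto intro: set_integrable_subset)
    have "norm (LBINT x:{a + real n<..}. f w x) \<le> (LBINT x:{a + real n<..}. norm (f w x))"
      by (rule set_integral_norm_bound[OF sub(1)])
    also have "\<dots> \<le> (LBINT x:{a + real n<..}. g x)"
      using le[OF w] by (intro set_integral_mono set_integrable_norm sub) auto
    finally show ?thesis
      by (simp add: tail int[OF w] g)
  qed
  have "filterlim (\<lambda>n. a + real n) at_top sequentially"
    by (rule filterlim_tendsto_add_at_top[OF tendsto_const filterlim_real_sequentially])
  then have lim: "(\<lambda>n. LBINT x:{a..a + real n}. g x) \<longlonglongrightarrow> (LBINT x:{a..}. g x)"
    by (intro filterlim_compose[OF tendsto_set_lebesgue_integral_at_top[OF _ g]]) auto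
  have "uniform_limit (cball z r) (\<lambda>n w. LBINT x:{a..a + real n}. f w x)
          (\<lambda>w. LBINT x:{a..}. f w x) sequentially"
  proof (rule uniform_limitI)
    fix e :: real assume "e > 0"
    have "\<forall>\<^sub>F n in sequentially. dist (LBINT x:{a..a + real n}. g x) (LBINT x:{a..}. g x) < e"
      using lim \<open>e > 0\<close> by (simp add: tendsto_iff)
    then show "\<forall>\<^sub>F n in sequentially. \<forall>w\<in>cball z r.
        dist (LBINT x:{a..a + real n}. f w x) (LBINT x:{a..}. f w x) < e"
    proof eventually_elim
      case (elim n)
      show ?case
        using bound[of _ n] elim by (force simp: dist_norm norm_minus_commute)
    qed
  qed
  then show "\<exists>d>0. cball z d \<subseteq> U \<and> uniform_limit (cball z d)
      (\<lambda>n w. LBINT x:{a..a + real n}. f w x) (\<lambda>w. LBINT x:{a..}. f w x) sequentially"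
    using r by blast
qed

section \<open>Holomorphy of the Xi function\<close>

text \<open>
  For \<open>x \<ge> 1\<close> one has \<open>\<pi>(n+1)\<^sup>2x \<ge> 2(n+1)x \<ge> n + 2x\<close>. This crude bound is enough: it gives both the
  uniform convergence of the series and the exponential decay of its sum.
\<close>

lemma omega_term_le:
  assumes "x \<ge> 1"
  shows "exp (- pi * (real (Suc n))\<^sup>2 * x) \<le> exp (- 1) ^ n * exp (- 2 * x)"
proof -
  have "real n + 2 * x \<le> 2 * real (Suc n) * x"
    using assms mult_left_mono[of 1 x "real n"] by (simp add: algebra_simps)
  also have "\<dots> \<le> pi * (real (Suc n))\<^sup>2 * x"
    using pi_gt3 assms by (intro mult_mono) (auto simp: power2_eq_square)
  finally have "- pi * (real (Suc n))\<^sup>2 * x \<le> - real n - 2 * x"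
    by simp
  also have "exp (- real n - 2 * x) = exp (- 1) ^ n * exp (- 2 * x)"
    by (simp flip: exp_of_nat_mult exp_add)
  finally show ?thesis
    by simp
qed

lemma summable_exp_minus_one_power: "summable (\<lambda>n. exp (- 1 :: real) ^ n)"
  by (rule summable_geometric) simp

lemma continuous_on_omega: "continuous_on {1..} omega"
proof -
  have "uniform_limit {1..} (\<lambda>N x. \<Sum>n<N. exp (- pi * (real (Suc n))\<^sup>2 * x))
          (\<lambda>x. \<Sum>n. exp (- pi * (real (Suc n))\<^sup>2 * x)) sequentially"
  proof (rule Weierstrass_m_test[OF _ summable_exp_minus_one_power])
    fix n and x :: real assume x: "x \<in> {1..}"
    then have "exp (- 1) ^ n * exp (- 2 * x) \<le> exp (- 1 :: real) ^ n"
      by (intro mult_left_le) auto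
    then have "exp (- pi * (real (Suc n))\<^sup>2 * x) \<le> exp (- 1) ^ n"
      by (rule order_trans[OF omega_term_le, rotated]) (use x in simp)
    then show "norm (exp (- pi * (real (Suc n))\<^sup>2 * x)) \<le> exp (- 1) ^ n"
      by (simp only: real_norm_def abs_exp_cancel)
  qed
  then have "continuous_on {1..} (\<lambda>x. \<Sum>n. exp (- pi * (real (Suc n))\<^sup>2 * x))"
    by (rule uniform_limit_theorem[rotated])
       (auto intro!: always_eventually continuous_intros)
  then show ?thesis
    by (simp add: omega_def[abs_def])
qed

lemma omega_bound:
  obtains C where "C \<ge> 0" "\<And>x. x \<ge> 1 \<Longrightarrow> \<bar>omega x\<bar> \<le> C * exp (- 2 * x)"
proof
  show "(\<Sum>n. exp (- 1 :: real) ^ n) \<ge> 0"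
    by (intro suminf_nonneg summable_exp_minus_one_power) simp
  fix x :: real assume x: "x \<ge> 1"
  have *: "summable (\<lambda>n. exp (- 1) ^ n * exp (- 2 * x))"
    by (intro summable_mult2 summable_exp_minus_one_power)
  have **: "summable (\<lambda>n. exp (- pi * (real (Suc n))\<^sup>2 * x))"
    by (rule summable_comparison_test'[OF *, of 0]) (use omega_term_le[OF x] in simp)
  have "omega x \<le> (\<Sum>n. exp (- 1) ^ n * exp (- 2 * x))"
    unfolding omega_def by (intro suminf_le * ** omega_term_le x)
  moreover have "omega x \<ge> 0"
    unfolding omega_def by (intro suminf_nonneg **) simp
  ultimately show "\<bar>omega x\<bar> \<le> (\<Sum>n. exp (- 1) ^ n) * exp (- 2 * x)"
    by (simp add: suminf_mult2[OF summable_exp_minus_one_power])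
qed

text \<open>
  This is the \<open>R\<close>-th power of the inequality \<open>x / R \<le> e\<^bsup>x/R\<^esup>\<close>.
\<close>

lemma powr_le_exp:
  fixes x R :: real
  assumes "x \<ge> 0" "R > 0"
  shows "x powr R \<le> R powr R * exp x"
proof -
  have "x / R \<le> exp (x / R)"
    using exp_ge_add_one_self[of "x / R"] by linarith
  then have "x \<le> R * exp (x / R)"
    using assms by (simp add: field_simps)
  then have "x powr R \<le> (R * exp (x / R)) powr R"
    using assms by (intro powr_mono2) auto
  also have "\<dots> = R powr R * exp x"
    using assms by (simp add: powr_mult exp_powr_real)
  finally show ?thesis .
qed

lemma set_integrable_exp_minus: "set_integrable lborel {a::real..} (\<lambda>x. exp (- x))"
proof -
  have "(\<lambda>x::real. exp (- x)) absolutely_integrable_on {a..}"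
    using has_integral_exp_minus_to_infinity[of 1 a]
    by (intro nonnegative_absolutely_integrable_1) (auto simp: has_integral_integrable)
  then show ?thesis
    unfolding set_integrable_def by (subst (asm) integrable_completion) auto
qed

lemma xi_integral_holomorphic:
  "(\<lambda>z. LBINT x:{1..}. (complex_of_real x powr (z / 2 - 1) + complex_of_real x powr (- (z + 1) / 2)) *
      complex_of_real (omega x)) holomorphic_on UNIV"
proof (rule holomorphic_on_integral_half_line)
  fix z :: complex and x :: real assume "x \<ge> 1"
  then have Ln: "complex_of_real x \<noteq> 0" "Ln (complex_of_real x) = of_real (ln x)"
    by (auto simp: Ln_of_real)
  show "((\<lambda>z. (complex_of_real x powr (z / 2 - 1) + complex_of_real x powr (- (z + 1) / 2)) *
          complex_of_real (omega x)) has_field_derivative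
      (of_real (ln x) / 2 * (complex_of_real x powr (z / 2 - 1)
        - complex_of_real x powr (- (z + 1) / 2)) * complex_of_real (omega x))) (at z)"
    by (rule derivative_eq_intros refl DERIV_chain2[OF has_field_derivative_powr_right] Ln(1)
          | simp)+
       (simp add: Ln(2) field_simps)
next
  have "continuous_on (UNIV \<times> {1..}) (\<lambda>p :: complex \<times> real. omega (snd p))"
    by (rule continuous_on_compose2[OF continuous_on_omega]) (auto intro!: continuous_intros)
  then show "continuous_on (UNIV \<times> {1..}) (\<lambda>(z, x). of_real (ln x) / 2 *
      (complex_of_real x powr (z / 2 - 1) - complex_of_real x powr (- (z + 1) / 2)) *
      complex_of_real (omega x))"
    unfolding case_prod_unfold
    by (intro continuous_intros) (auto simp: complex_nonpos_Reals_iff)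
next
  fix z :: complex
  show "continuous_on {1..} (\<lambda>x. (complex_of_real x powr (z / 2 - 1)
      + complex_of_real x powr (- (z + 1) / 2)) * complex_of_real (omega x))"
    by (intro continuous_intros continuous_on_omega) (auto simp: complex_nonpos_Reals_iff)
next
  fix z :: complex
  obtain C where C: "C \<ge> 0" "\<And>x. x \<ge> 1 \<Longrightarrow> \<bar>omega x\<bar> \<le> C * exp (- 2 * x)"
    using omega_bound by blast
  \<comment> \<open>An upper bound on the real parts of both exponents over the unit disc about \<open>z\<close>.\<close>
  define R where "R = norm z + 1"
  have "R > 0"
    unfolding R_def using norm_ge_zero[of z] by linarith
  define g where "g = (\<lambda>x. 2 * (R powr R) * C * exp (- x))"
  have bound: "norm ((complex_of_real x powr (w / 2 - 1) + complex_of_real x powr (- (w + 1) / 2)) *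
      complex_of_real (omega x)) \<le> g x" if w: "w \<in> cball z 1" and x: "x \<ge> 1" for w x
  proof -
    have "norm w \<le> R"
      using w norm_triangle_ineq2[of w z] by (simp add: R_def dist_norm norm_minus_commute)
    then have Re: "\<bar>Re w\<bar> \<le> R"
      using abs_Re_le_cmod order_trans by blast
    have "norm (complex_of_real x powr s) \<le> R powr R * exp x" if "Re s \<le> R" for s
    proof -
      have "norm (complex_of_real x powr s) = x powr Re s"
        using x by (simp add: norm_powr_real_powr)
      also have "\<dots> \<le> x powr R"
        using x that by (intro powr_mono) auto
      also have "\<dots> \<le> R powr R * exp x"
        using x \<open>R > 0\<close> by (intro powr_le_exp) auto
      finally show ?thesis .
    qed
    then have "norm (complex_of_real x powr (w / 2 - 1)) \<le> R powr R * exp x"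
      "norm (complex_of_real x powr (- (w + 1) / 2)) \<le> R powr R * exp x"
      using Re \<open>R > 0\<close> by auto
    then have "norm (complex_of_real x powr (w / 2 - 1) + complex_of_real x powr (- (w + 1) / 2))
        \<le> 2 * (R powr R) * exp x"
      by (intro norm_triangle_le) simp
    then have "norm ((complex_of_real x powr (w / 2 - 1) + complex_of_real x powr (- (w + 1) / 2)) *
      complex_of_real (omega x)) \<le> (2 * (R powr R) * exp x) * (C * exp (- 2 * x))"
      unfolding norm_mult using C(2)[OF x] by (intro mult_mono) auto
    also have "\<dots> = g x"
      by (simp add: g_def flip: exp_add)
    finally show ?thesis .
  qed
  have "set_integrable lborel {1..} g"
    unfolding g_def by (intro set_integrable_mult_right set_integrable_exp_minus)
  with bound show "\<exists>r>0. \<exists>g::real \<Rightarrow> real. cball z r \<subseteq> UNIV \<and> set_integrable lborel {1..} g \<and>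
      (\<forall>w\<in>cball z r. \<forall>x\<ge>1. norm ((complex_of_real x powr (w / 2 - 1)
        + complex_of_real x powr (- (w + 1) / 2)) * complex_of_real (omega x)) \<le> g x)"
    by (intro exI[of _ 1] exI[of _ g]) auto
qed auto

lemma xi_holomorphic: "xi holomorphic_on - {0, 1}"
  unfolding xi_def[abs_def]
  by (intro holomorphic_intros holomorphic_on_subset[OF xi_integral_holomorphic]) auto

section \<open>Extrema on the critical line\<close>

lemma not_interior_critical_line: "z \<notin> interior {z. Re z = 1 / 2}"
proof
  have "{z. Re z = 1 / 2} = {z. 1 \<bullet> z = (1 / 2 :: real)}"
    by (simp add: inner_complex_def)
  moreover assume "z \<in> interior {z. Re z = 1 / 2}"
  ultimately show False
    using interior_hyperplane[of "1 :: complex" "1 / 2"] by auto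
qed

lemma eventually_critical_line:
  assumes "\<forall>\<^sub>F t in nhds t\<^sub>0. P (Complex (1 / 2) t)"
  shows "\<forall>\<^sub>F z in nhds (Complex (1 / 2) t\<^sub>0). z \<in> {z. Re z = 1 / 2} \<longrightarrow> P z"
proof -
  have "filterlim Im (nhds t\<^sub>0) (nhds (Complex (1 / 2) t\<^sub>0))"
    using tendsto_Im[OF filterlim_ident, of "Complex (1 / 2) t\<^sub>0"] by simp
  then have "\<forall>\<^sub>F z in nhds (Complex (1 / 2) t\<^sub>0). P (Complex (1 / 2) (Im z))"
    using assms by (rule eventually_compose_filterlim[rotated])
  then show ?thesis
  proof eventually_elim
    case (elim z)
    moreover have "Complex (1 / 2) (Im z) = z" if "Re z = 1 / 2"
      using that by (simp add: complex_eq_iff)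
    ultimately show ?case
      by auto
  qed
qed

theorem mainTheorem6:
  fixes t\<^sub>0 :: real
  assumes "local_max_at (\<lambda>t. Re (xi (Complex (1 / 2) t))) t\<^sub>0 \<or>
           local_min_at (\<lambda>t. Re (xi (Complex (1 / 2) t))) t\<^sub>0"
  shows "Complex (1 / 2) t\<^sub>0 \<in>
           closure {z. z \<notin> {0, 1} \<and> Im (xi z) = 0 \<and> Re z \<noteq> 1 / 2}"
proof -
  let ?z = "Complex (1 / 2) t\<^sub>0" and ?L = "{z. Re z = 1 / 2}"
  have S: "open (- {0, 1 :: complex})" "?z \<in> - {0, 1}"
    by (auto simp: complex_eq_iff)
  have real: "Im (xi ?z) = 0"
    by (metis Im_complex_of_real xi_critical_line_real)
  have "?z \<in> closure {z \<in> - {0, 1} - ?L. Im (xi z) = 0}"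
    using assms
  proof
    assume "local_max_at (\<lambda>t. Re (xi (Complex (1 / 2) t))) t\<^sub>0"
    then have "\<forall>\<^sub>F z in nhds ?z. z \<in> ?L \<longrightarrow> Re (xi z) \<le> Re (xi ?z)"
      unfolding local_max_at_def by (rule eventually_critical_line)
    then show ?thesis
      by (rule local_max_imp_closure_real_level
            [OF xi_holomorphic S real _ not_interior_critical_line])
  next
    assume "local_min_at (\<lambda>t. Re (xi (Complex (1 / 2) t))) t\<^sub>0"
    then have "\<forall>\<^sub>F z in nhds ?z. z \<in> ?L \<longrightarrow> Re (xi ?z) \<le> Re (xi z)"
      unfolding local_min_at_def by (rule eventually_critical_line)
    then have "\<forall>\<^sub>F z in nhds ?z. z \<in> ?L \<longrightarrow> Re (- xi z) \<le> Re (- xi ?z)"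
      by simp
    then have "?z \<in> closure {z \<in> - {0, 1} - ?L. Im (- xi z) = 0}"
      using real by (intro local_max_imp_closure_real_level holomorphic_on_minus xi_holomorphic S
          not_interior_critical_line) auto
    then show ?thesis
      by simp
  qed
  also have "{z \<in> - {0, 1} - ?L. Im (xi z) = 0} = {z. z \<notin> {0, 1} \<and> Im (xi z) = 0 \<and> Re z \<noteq> 1 / 2}"
    by auto
  finally show ?thesis .
qed

end
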